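(* Let $1\leq q<3$ and $a\in\mathbb{R}\setminus\{0\}$. Then $\mathrm{Ent}_{q,1}=a\,\mathrm{Ent}_{q,a}$ as functions on $\mathcal{S}_q$. Moreover, if $a\neq 1$, then for every $\lambda\in\mathbb{R}$ one has $D^{(q,1)}\neq\lambda D^{(q,a)}$ as functions on $\mathcal{S}_q\times\mathcal{S}_q$.
   Context: Let $1\le q<3$ and $a\in\mathbb{R}\setminus\{0\}$. The $q$-logarithm is $\ln_q(t):=\int_1^t s^{-q}\,ds$ for $t\in(0,\infty)$, and $\exp_q$ denotes the inverse function of $\ln_q:(0,\infty)\to\ln_q(0,\infty)$. The $a$-refined $q$-logarithm $\ln_{q,a}:(0,1)\to\mathbb{R}$ is $\ln_{q,a}(t):=-\frac1a(-\ln_q(t))^a$; it is strictly increasing with $\ln_{q,a}'(t)=1/\big(t^q(-\ln_q(t))^{1-a}\big)$. Put $Z_q:=\sqrt{3-q}\int_{\mathbb{R}}\exp_q(-x^2)\,dx$ (so $Z_1=\sqrt{2\pi}$, and $Z_q=\sqrt{\frac{3-q}{q-1}}\,B\big(\frac{3-q}{2(q-1)},\frac12\big)$ for $1<q<3$, where $B$ is the beta function). For $\xi=(\mu,\sigma)\in\mathbb{R}\times(0,\infty)$ the $q$-Gaussian density is $$p_q(x;\xi)=\frac{1}{Z_q\sigma}\exp_q\!\Big(-\frac{1}{3-q}\Big(\frac{x-\mu}{\sigma}\Big)^2\Big),\qquad x\in\mathbb{R}.$$ Set $\Sigma_q:=\{\sigma>0: \frac{1}{Z_q\sigma}<1\}$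 and $\mathcal{S}_q:=\{p_q(\cdot;\xi):\xi\in\mathbb{R}\times\Sigma_q\}$, so every $p\in\mathcal{S}_q$ takes values in $(0,1)$. For $p,r\in\mathcal{S}_q$ define the $(q,a)$-cross entropy, the $(q,a)$-entropy and the $(q,a)$-relative entropy by $$d_{q,a}(p,r):=-\int_{\mathbb{R}}\ln_{q,a}(r(x))\,\frac{1}{\ln_{q,a}'(p(x))}\,dx,\quad \mathrm{Ent}_{q,a}(p):=d_{q,a}(p,p),\quad D^{(q,a)}(p,r):=-d_{q,a}(p,p)+d_{q,a}(p,r).$$ (These integrals converge.) *)

theory Defs
  imports "HOL-Analysis.Analysis"
begin

(* The interval integral is oriented: for t < 1 it is minus the integral over (t, 1). *)
definition ln_q :: "real \<Rightarrow> real \<Rightarrow> real" where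
  "ln_q q t = (LBINT s=ereal 1..ereal t. s powr (- q))"

(* Specified only on the image of the positive reals under ln_q q;
   for q \<ge> 1 this image contains all of {..0}. *)
definition exp_q :: "real \<Rightarrow> real \<Rightarrow> real" where
  "exp_q q = the_inv_into {0<..} (ln_q q)"

(* Meaningful for 0 < t < 1, where - ln_q q t > 0. *)
definition ln_qa :: "real \<Rightarrow> real \<Rightarrow> real \<Rightarrow> real" where
  "ln_qa q a t = - (1 / a) * (- ln_q q t) powr a"

definition Z_q :: "real \<Rightarrow> real" where
  "Z_q q = sqrt (3 - q) * (LBINT x. exp_q q (- (x ^ 2)))"

definition q_gaussian :: "real \<Rightarrow> real \<Rightarrow> real \<Rightarrow> real \<Rightarrow> real" where
  "q_gaussian q \<mu> \<sigma> x =
     1 / (Z_q q * \<sigma>) * exp_q q (- (1 / (3 - q)) * ((x - \<mu>) / \<sigma>) ^ 2)"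

definition Sigma_q :: "real \<Rightarrow> real set" where
  "Sigma_q q = {\<sigma>. \<sigma> > 0 \<and> 1 / (Z_q q * \<sigma>) < 1}"

definition S_q :: "real \<Rightarrow> (real \<Rightarrow> real) set" where
  "S_q q = {q_gaussian q \<mu> \<sigma> | \<mu> \<sigma>. \<sigma> \<in> Sigma_q q}"

definition cross_entropy ::
    "real \<Rightarrow> real \<Rightarrow> (real \<Rightarrow> real) \<Rightarrow> (real \<Rightarrow> real) \<Rightarrow> real" where
  "cross_entropy q a p r =
     - (LBINT x. ln_qa q a (r x) * (1 / deriv (ln_qa q a) (p x)))"

definition Ent :: "real \<Rightarrow> real \<Rightarrow> (real \<Rightarrow> real) \<Rightarrow> real" where
  "Ent q a p = cross_entropy q a p p"

definition rel_entropy ::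
    "real \<Rightarrow> real \<Rightarrow> (real \<Rightarrow> real) \<Rightarrow> (real \<Rightarrow> real) \<Rightarrow> real" where
  "rel_entropy q a p r = - cross_entropy q a p p + cross_entropy q a p r"

end

theory Submission imports Defs begin

text \<open>Write \<open>L = - ln_q\<close>. The integrand of the \<open>(q,a)\<close>-cross entropy of \<open>p\<close> and \<open>r\<close> is
  \<open>p\<^sup>q L(r)\<^sup>a L(p)\<^sup>1\<^sup>-\<^sup>a / a\<close>, which for \<open>r = p\<close> depends on \<open>a\<close> only through the factor \<open>1 / a\<close>.
  For the second claim take \<open>p\<close> and \<open>r\<close> of equal width \<open>\<sigma>\<close> with means \<open>0\<close> and \<open>\<sigma>\<close>. After the
  substitution \<open>x = \<sigma> z\<close> both relative entropies depend on \<open>\<sigma>\<close> only through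
  \<open>k = (3 - q) ln_q (Z_q \<sigma>)\<close>: for \<open>a = 1\<close> the result is a nonzero constant, and in general it is, up to
  an affine function of \<open>k\<close>, a multiple of the integral of
  \<open>(k + (z - 1)\<^sup>2)\<^sup>a (k + z\<^sup>2)\<^sup>1\<^sup>-\<^sup>a\<close> against a positive weight. The map \<open>(u, v) \<mapsto> u\<^sup>a v\<^sup>1\<^sup>-\<^sup>a\<close> being
  strictly convex or strictly concave off the rays when \<open>a\<close> is neither \<open>0\<close> nor \<open>1\<close>, that integral is not
  affine in \<open>k\<close>, so proportionality is impossible.\<close>

section \<open>The deformed logarithm and exponential\<close>

lemma ln_q_eq:
  assumes "t > 0"
  shows "ln_q q t = (if q = 1 then ln t else (t powr (1 - q) - 1) / (1 - q))"
proof -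
  define F where "F = (\<lambda>t::real. if q = 1 then ln t else (t powr (1 - q) - 1) / (1 - q))"
  have D: "(F has_real_derivative x powr (- q)) (at x)" if "x > 0" for x
  proof (cases "q = 1")
    case True
    then show ?thesis
      using that by (auto simp: F_def powr_minus field_simps intro!: derivative_eq_intros)
  next
    case False
    then show ?thesis
      using that by (auto simp: F_def intro!: derivative_eq_intros)
  qed
  have pos: "x > 0" if "min 1 t \<le> x" for x
    using that assms by (auto simp: min_def split: if_splits)
  \<comment> \<open>The oriented integral lets one application of the fundamental theorem cover both
    \<open>t < 1\<close> and \<open>t > 1\<close>.\<close>
  have "(LBINT s=ereal 1..ereal t. s powr (- q)) = F t - F 1"
  proof (rule interval_integral_FTC_finite)
    show "continuous_on {min 1 t..max 1 t} (\<lambda>s. s powr (- q))"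
      using pos by (force intro!: continuous_intros)
    show "(F has_vector_derivative x powr (- q)) (at x within {min 1 t..max 1 t})"
      if "min 1 t \<le> x" for x
      using D[OF pos[OF that]]
      by (simp add: has_real_derivative_iff_has_vector_derivative has_vector_derivative_at_within)
  qed
  then show ?thesis by (simp add: ln_q_def F_def)
qed

lemma ln_q_1 [simp]: "ln_q q 1 = 0"
  by (simp add: ln_q_eq)

lemma has_real_derivative_ln_q:
  assumes "t > 0"
  shows "(ln_q q has_real_derivative t powr (- q)) (at t)"
proof -
  have D: "((\<lambda>t. if q = 1 then ln t else (t powr (1 - q) - 1) / (1 - q))
      has_real_derivative t powr (- q)) (at t)"
  proof (cases "q = 1")
    case True
    then show ?thesis
      using assms by (auto simp: powr_minus field_simps intro!: derivative_eq_intros)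
  next
    case False
    then show ?thesis
      using assms by (auto intro!: derivative_eq_intros)
  qed
  \<comment> \<open>The closed form is known only on the positive reals, which contain a
    neighbourhood of \<open>t\<close>; that suffices for the derivative.\<close>
  have "\<forall>\<^sub>F x in nhds t. x \<in> {0<..}"
    using assms by (intro eventually_nhds_in_open) auto
  then have "\<forall>\<^sub>F x in nhds t. ln_q q x = (if q = 1 then ln x else (x powr (1 - q) - 1) / (1 - q))"
    by eventually_elim (simp add: ln_q_eq)
  from DERIV_cong_ev[OF refl this refl] D show ?thesis by simp
qed

lemma ln_q_less:
  assumes "0 < s" "s < t"
  shows "ln_q q s < ln_q q t"
proof (rule DERIV_pos_imp_increasing[OF assms(2)])
  fix x assume "s \<le> x" "x \<le> t"
  then have "x > 0" using assms by simp
  then show "\<exists>y. (ln_q q has_real_derivative y) (at x) \<and> 0 < y"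
    using has_real_derivative_ln_q by force
qed

lemma ln_q_neg: "0 < t \<Longrightarrow> t < 1 \<Longrightarrow> ln_q q t < 0"
  using ln_q_less[of t 1 q] by simp

lemma ln_q_mult:
  assumes "s > 0" "t > 0"
  shows "ln_q q (s * t) = ln_q q s + s powr (1 - q) * ln_q q t"
proof (cases "q = 1")
  case True
  then show ?thesis using assms by (simp add: ln_q_eq ln_mult)
next
  case False
  then show ?thesis
    using assms by (simp add: ln_q_eq powr_mult right_diff_distrib flip: add_divide_distrib)
qed

text \<open>Solves \<open>ln_q_mult\<close> at \<open>t / s\<close>. It serves to split off the
  normalising factor \<open>s\<close> of a q-Gaussian density.\<close>

lemma ln_q_divide:
  assumes "s > 0" "t > 0"
  shows "ln_q q (t / s) = s powr (q - 1) * (ln_q q t - ln_q q s)"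
proof -
  have "ln_q q t = ln_q q s + s powr (1 - q) * ln_q q (t / s)"
    using ln_q_mult[of s "t / s" q] assms by simp
  then have "s powr (q - 1) * (ln_q q t - ln_q q s)
      = (s powr (q - 1) * s powr (1 - q)) * ln_q q (t / s)"
    by (simp add: algebra_simps)
  also have "s powr (q - 1) * s powr (1 - q) = 1"
    using assms by (simp add: powr_add[symmetric])
  finally show ?thesis by simp
qed

section \<open>The inverse function on the non-positive axis\<close>

lemma inj_on_ln_q: "inj_on (ln_q q) {0<..}"
  by (rule inj_onI) (metis greaterThan_iff less_irrefl linorder_neqE ln_q_less)

lemma exp_q_ln_q: "t > 0 \<Longrightarrow> exp_q q (ln_q q t) = t"
  unfolding exp_q_def by (rule the_inv_into_f_f[OF inj_on_ln_q]) simp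

lemma one_plus_q_pos: "1 \<le> q \<Longrightarrow> 0 \<le> y \<Longrightarrow> 1 + (q - 1) * y > (0::real)"
  by (simp add: add_pos_nonneg)

text \<open>For \<open>q \<ge> 1\<close> and \<open>y \<ge> 0\<close> the base
  \<open>1 + (q - 1) * y\<close> is positive, so the explicit candidate is a positive real. Its
  \<open>ln_q\<close> is computed to be \<open>- y\<close>, and injectivity of \<open>ln_q\<close>
  then identifies it with \<open>exp_q q (- y)\<close>.\<close>

lemma
  assumes "1 \<le> q" "0 \<le> y"
  shows exp_q_eq: "exp_q q (- y) =
      (if q = 1 then exp (- y) else (1 + (q - 1) * y) powr (- 1 / (q - 1)))" (is "_ = ?t")
    and exp_q_pos: "exp_q q (- y) > 0"
    and ln_q_exp_q: "ln_q q (exp_q q (- y)) = - y"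
proof -
  have w: "1 + (q - 1) * y > 0"
    using assms by (rule one_plus_q_pos)
  then have pos: "?t > 0" by simp
  have ln: "ln_q q ?t = - y"
  proof (cases "q = 1")
    case True
    then show ?thesis by (simp add: ln_q_eq)
  next
    case False
    have "- 1 / (q - 1) * (1 - q) = 1"
      using False by (simp add: divide_simps)
    then have "?t powr (1 - q) = 1 + (q - 1) * y"
      using w False by (simp only: powr_powr if_False powr_one)
    then show ?thesis
      using False pos by (simp add: ln_q_eq divide_simps algebra_simps)
  qed
  show "exp_q q (- y) = ?t"
    using exp_q_ln_q[OF pos, of q] ln by simp
  with pos ln show "exp_q q (- y) > 0" "ln_q q (exp_q q (- y)) = - y"
    by simp_all
qed

lemma exp_q_le_1:
  assumes "1 \<le> q" "0 \<le> y"
  shows "exp_q q (- y) \<le> 1"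
  using ln_q_less[of 1 "exp_q q (- y)" q] ln_q_exp_q[OF assms] assms by force

text \<open>The closed form of \<open>exp_q\<close> is at hand only for non-positive arguments,
  hence a statement about this composite and not about \<open>exp_q q\<close> itself.\<close>

lemma exp_q_measurable:
  assumes "1 \<le> q" "0 \<le> b"
  shows "(\<lambda>x. exp_q q (- (b * x\<^sup>2))) \<in> borel_measurable borel"
proof -
  have "(\<lambda>x. exp_q q (- (b * x\<^sup>2))) = (\<lambda>x. if q = 1 then exp (- (b * x\<^sup>2))
      else (1 + (q - 1) * (b * x\<^sup>2)) powr (- 1 / (q - 1)))"
    using assms by (auto simp: exp_q_eq)
  then show ?thesis by simp
qed

section \<open>Integrability of the escort weight\<close>

text \<open>A nonnegative function with integral 0 vanishes almost everywhere; together with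
  positivity this would make \<open>lborel\<close> the zero measure.\<close>

lemma lborel_integral_pos:
  fixes f :: "real \<Rightarrow> real"
  assumes "integrable lborel f" and pos: "AE x in lborel. f x > 0"
  shows "(LBINT x. f x) > 0"
proof -
  have nn: "AE x in lborel. 0 \<le> f x"
    using pos by eventually_elim simp
  have "(LBINT x. f x) \<noteq> 0"
  proof
    assume "(LBINT x. f x) = 0"
    then have "AE x in lborel. f x = 0"
      using integral_nonneg_eq_0_iff_AE[OF assms(1) nn] by simp
    with pos have "AE x::real in lborel. False"
      by eventually_elim simp
    then show False
      by (simp add: eventually_False ae_filter_eq_bot_iff)
  qed
  with integral_nonneg_AE[OF nn] show ?thesis by simp
qed

text \<open>Domination by 1 on [-1, 1] and by the power of \<open>\<bar>x\<bar>\<close> with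
  exponent \<open>- 2 * b\<close> on the two tails, which is integrable at infinity because
  \<open>2 * b > 1\<close>.\<close>

lemma integrable_powr_one_plus_square:
  assumes "b > (1/2::real)"
  shows "integrable lborel (\<lambda>x::real. (1 + x\<^sup>2) powr (- b))"
proof -
  let ?g = "\<lambda>x::real. indicator {1..} x *\<^sub>R x powr (- 2 * b)"
  have "(\<lambda>x::real. x powr (- 2 * b)) integrable_on {1..}"
    using has_integral_powr_to_inf[of "- 2 * b" 1] assms by (auto simp: integrable_on_def)
  then have "(\<lambda>x::real. x powr (- 2 * b)) absolutely_integrable_on {1..}"
    by (intro nonnegative_absolutely_integrable_1) auto
  then have "integrable lebesgue ?g"
    by (simp add: set_integrable_def)
  then have g: "integrable lborel ?g"
    by (subst (asm) integrable_completion) auto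
  then have g': "integrable lborel (\<lambda>x. ?g (- x))"
    using lborel_integrable_real_affine[of ?g "- 1" 0] by simp
  have i: "integrable lborel (indicator {-1..1} :: real \<Rightarrow> real)"
    by simp
  show ?thesis
  proof (rule Bochner_Integration.integrable_bound)
    show "integrable lborel (\<lambda>x. indicator {-1..1} x + (?g x + ?g (- x)))"
      by (intro Bochner_Integration.integrable_add i g g')
    show "AE x in lborel. norm ((1 + x\<^sup>2) powr (- b))
        \<le> norm (indicator {-1..1} x + (?g x + ?g (- x)))"
    proof (intro AE_I2)
      fix x :: real
      have nn: "?g x \<ge> 0" "?g (- x) \<ge> 0" for x :: real
        by (auto simp: indicator_def)
      consider "\<bar>x\<bar> \<le> 1" | "x > 1" | "x < -1" by linarith
      then show "norm ((1 + x\<^sup>2) powr (- b)) \<le> norm (indicator {-1..1} x + (?g x + ?g (- x)))"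
      proof cases
        case 1
        have "(1 + x\<^sup>2) powr (- b) \<le> 1"
          using powr_mono[of "- b" 0 "1 + x\<^sup>2"] assms by (simp split: if_splits)
        moreover have "?g x + ?g (- x) \<ge> 0"
          using nn[of x] by (rule add_nonneg_nonneg)
        ultimately show ?thesis using 1 by (simp add: abs_le_iff del: real_scaleR_def)
      next
        case 2
        have "(1 + x\<^sup>2) powr (- b) \<le> (x\<^sup>2) powr (- b)"
          using assms 2 by (intro powr_mono2') auto
        also have "\<dots> = x powr (- 2 * b)"
          using 2 by (simp add: powr_powr flip: powr_numeral)
        finally show ?thesis using 2 by simp
      next
        case 3
        have "(1 + x\<^sup>2) powr (- b) \<le> ((- x)\<^sup>2) powr (- b)"
          using assms 3 by (intro powr_mono2') auto
        also have "\<dots> = (- x) powr (- 2 * b)"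
          using 3 by (simp add: powr_powr del: power2_minus flip: powr_numeral)
        finally show ?thesis using 3 by simp
      qed
    qed
  qed simp
qed

text \<open>With \<open>y\<close> quadratic in \<open>x\<close>, the bound is integrable. For
  \<open>q > 1\<close> the exponent \<open>q / (q - 1)\<close> equals
  \<open>1 + 1 / (q - 1)\<close>: one unit absorbs the factor \<open>1 + y\<close>, and the
  remainder \<open>1 / (q - 1)\<close> exceeds 1/2 exactly because \<open>q < 3\<close>.\<close>

lemma exp_q_powr_decay:
  assumes "1 \<le> q" "q < 3"
  obtains C b where "b > 1/2"
    "\<And>y. 0 \<le> y \<Longrightarrow> exp_q q (- y) powr q * (1 + y) \<le> C * (1 + y) powr (- b)"
proof (cases "q = 1")
  case True
  have "exp_q q (- y) powr q * (1 + y) \<le> 4 * (1 + y) powr (- 1)" if "y \<ge> 0" for y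
  proof -
    \<comment> \<open>Halving the argument before using \<open>1 + x \<le> exp x\<close> gives
      quadratic growth of \<open>exp y\<close>, one power more than the factor \<open>1 + y\<close>
      needs.\<close>
    have "(1 + y)\<^sup>2 \<le> 4 * (1 + y / 2)\<^sup>2"
      using that by (simp add: power2_eq_square algebra_simps)
    also have "\<dots> \<le> 4 * (exp (y / 2))\<^sup>2"
      using that exp_ge_add_one_self[of "y / 2"] by (intro mult_left_mono power_mono) auto
    also have "\<dots> = 4 * exp y"
      by (simp add: power2_eq_square flip: exp_add)
    finally have "(1 + y) / exp y \<le> 4 / (1 + y)"
      using that by (simp add: divide_simps power2_eq_square)
    then show ?thesis
      using that True by (simp add: exp_q_eq exp_minus powr_minus_divide divide_inverse mult.commute)
  qed
  then show ?thesis by (intro that[of 1 4]) auto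
next
  case False
  then have q: "q > 1" using assms by simp
  define b where "b = 1 / (q - 1)"
  \<comment> \<open>Chosen so that \<open>c * (1 + y)\<close> is a lower bound for
    \<open>1 + (q - 1) * y\<close>.\<close>
  define c where "c = min 1 (q - 1)"
  have c: "c > 0" using q by (simp add: c_def)
  have "b > 1/2" using q assms by (simp add: b_def field_simps)
  have "exp_q q (- y) powr q * (1 + y) \<le> c powr (- b) / c * (1 + y) powr (- b)" if y: "y \<ge> 0" for y
  proof -
    let ?w = "1 + (q - 1) * y"
    have w: "?w \<ge> c * (1 + y)"
      proof -
      have "c * 1 \<le> 1" "c * y \<le> (q - 1) * y"
        using y by (auto simp: c_def intro: mult_right_mono)
      then show ?thesis by (simp add: distrib_left)
    qed
    have w0: "c * (1 + y) > 0" using c y by simp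
    then have wp: "?w > 0" using w by linarith
    have "- 1 / (q - 1) * q = - b - 1"
      using q by (simp add: b_def divide_simps)
    then have "exp_q q (- y) powr q = ?w powr (- b - 1)"
      using q y by (simp add: exp_q_eq powr_powr)
    also have "\<dots> = ?w powr (- b) / ?w"
      using wp by (simp add: powr_diff)
    finally have "exp_q q (- y) powr q * (1 + y) = ?w powr (- b) * ((1 + y) / ?w)"
      by simp
    also have "\<dots> \<le> (c * (1 + y)) powr (- b) * (1 / c)"
    proof (rule mult_mono)
      show "?w powr (- b) \<le> (c * (1 + y)) powr (- b)"
        using w w0 \<open>b > 1/2\<close> by (intro powr_mono2') auto
      show "(1 + y) / ?w \<le> 1 / c"
        using w wp c by (simp add: field_simps)
    qed (use y wp in auto)
    finally show ?thesis using c y by (simp add: powr_mult)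
  qed
  then show ?thesis using that \<open>b > 1/2\<close> by blast
qed

text \<open>Up to a constant factor, the q-th power of the q-Gaussian with mean 0 and width 1, that
  is, its unnormalised escort density.\<close>

definition escort :: "real \<Rightarrow> real \<Rightarrow> real" where
  "escort q z = exp_q q (- (z\<^sup>2 / (3 - q))) powr q"

context
  fixes q :: real
  assumes q: "1 \<le> q" "q < 3"
begin

lemma escort_pos: "escort q z > 0"
  using q exp_q_pos[of q "z\<^sup>2 / (3 - q)"] by (simp add: escort_def)

lemma escort_minus: "escort q (- z) = escort q z"
  by (simp add: escort_def)

lemma escort_measurable [measurable]: "escort q \<in> borel_measurable borel"
proof -
  have "escort q = (\<lambda>z. exp_q q (- (1 / (3 - q) * z\<^sup>2)) powr q)"
    by (simp add: escort_def fun_eq_iff)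
  also have "\<dots> \<in> borel_measurable borel"
    using q by (intro powr_real_measurable exp_q_measurable borel_measurable_const) auto
  finally show ?thesis .
qed

text \<open>The case \<open>d = 3 - q\<close> serves the escort weight, the case
  \<open>d = 1\<close> the integral in \<open>Z_q\<close>.\<close>

lemma integrable_exp_q_powr:
  assumes "d > 0"
  shows "integrable lborel (\<lambda>x. exp_q q (- (x\<^sup>2 / d)) powr q * (1 + x\<^sup>2 / d))"
proof -
  obtain C b where b: "b > 1/2"
    and C: "\<And>y. 0 \<le> y \<Longrightarrow> exp_q q (- y) powr q * (1 + y) \<le> C * (1 + y) powr (- b)"
    using exp_q_powr_decay q by blast
  have "integrable lborel (\<lambda>x. C * (1 + x\<^sup>2) powr (- b))"
    using integrable_powr_one_plus_square[OF b] by simp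
  from lborel_integrable_real_affine[OF this, of "1 / sqrt d" 0]
  have int: "integrable lborel (\<lambda>x. C * (1 + x\<^sup>2 / d) powr (- b))"
    using assms by (simp add: power_divide)
  have "(\<lambda>x. exp_q q (- (1 / d * x\<^sup>2))) \<in> borel_measurable borel"
    using assms q by (intro exp_q_measurable) auto
  then have [measurable]: "(\<lambda>x. exp_q q (- (x\<^sup>2 / d))) \<in> borel_measurable borel"
    by simp
  show ?thesis
  proof (rule Bochner_Integration.integrable_bound[OF int])
    show "AE x in lborel. norm (exp_q q (- (x\<^sup>2 / d)) powr q * (1 + x\<^sup>2 / d))
        \<le> norm (C * (1 + x\<^sup>2 / d) powr (- b))"
    proof (intro AE_I2)
      fix x
      have "exp_q q (- (x\<^sup>2 / d)) powr q * (1 + x\<^sup>2 / d) \<ge> 0" using assms by simp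
      with C[of "x\<^sup>2 / d"] assms
      show "norm (exp_q q (- (x\<^sup>2 / d)) powr q * (1 + x\<^sup>2 / d))
          \<le> norm (C * (1 + x\<^sup>2 / d) powr (- b))"
        by simp
    qed
  qed measurable
qed

lemma integrable_escort_square: "integrable lborel (\<lambda>z. escort q z * (1 + z\<^sup>2))"
proof (rule Bochner_Integration.integrable_bound)
  show "integrable lborel
      (\<lambda>z. 3 * (exp_q q (- (z\<^sup>2 / (3 - q))) powr q * (1 + z\<^sup>2 / (3 - q))))"
    using integrable_exp_q_powr[of "3 - q"] q by simp
  show "AE z in lborel. norm (escort q z * (1 + z\<^sup>2))
      \<le> norm (3 * (exp_q q (- (z\<^sup>2 / (3 - q))) powr q * (1 + z\<^sup>2 / (3 - q))))"
  proof (intro AE_I2)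
    fix z :: real
    \<comment> \<open>The constant 3 works because \<open>0 < 3 - q \<le> 3\<close>.\<close>
    have "1 + z\<^sup>2 \<le> 3 * (1 + z\<^sup>2 / (3 - q))"
    proof -
      have "(3 - q) * z\<^sup>2 \<le> 3 * z\<^sup>2"
        using q by (intro mult_right_mono) auto
      then have "z\<^sup>2 \<le> 3 * z\<^sup>2 / (3 - q)"
        using q by (simp add: pos_le_divide_eq mult.commute)
      then show ?thesis by simp
    qed
    then have "escort q z * (1 + z\<^sup>2) \<le> escort q z * (3 * (1 + z\<^sup>2 / (3 - q)))"
      using escort_pos[of z] by (intro mult_left_mono) auto
    then show "norm (escort q z * (1 + z\<^sup>2))
        \<le> norm (3 * (exp_q q (- (z\<^sup>2 / (3 - q))) powr q * (1 + z\<^sup>2 / (3 - q))))"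
      using escort_pos[of z] q
      by (simp add: escort_def abs_mult mult.left_commute add_nonneg_nonneg)
  qed
qed measurable

lemma integrable_escort: "integrable lborel (escort q)"
  using escort_pos
  by (intro Bochner_Integration.integrable_bound[OF integrable_escort_square])
    (auto intro!: AE_I2 simp: abs_mult less_imp_le)

lemma integrable_escort_power2: "integrable lborel (\<lambda>z. escort q z * z\<^sup>2)"
  using Bochner_Integration.integrable_diff[OF integrable_escort_square integrable_escort]
  by (simp add: algebra_simps)

lemma integrable_escort_ident: "integrable lborel (\<lambda>z. escort q z * z)"
proof (rule Bochner_Integration.integrable_bound[OF integrable_escort_square])
  show "AE z in lborel. norm (escort q z * z) \<le> norm (escort q z * (1 + z\<^sup>2))"
  proof (intro AE_I2)
    fix z :: real
    have "\<bar>z\<bar> \<le> 1 + z\<^sup>2"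
      using zero_le_power2[of "\<bar>z\<bar> - 1"] by (simp add: power2_eq_square algebra_simps)
    then show "norm (escort q z * z) \<le> norm (escort q z * (1 + z\<^sup>2))"
      using escort_pos[of z] by (simp add: abs_mult mult_left_mono)
  qed
qed measurable

text \<open>The weight is even, so reflection changes the sign of the integral. This removes the
  linear term when a shifted square is expanded.\<close>

lemma integral_escort_ident: "(LBINT z. escort q z * z) = 0"
proof -
  have "(LBINT z. escort q z * z) = - (LBINT z. escort q z * z)"
    using lborel_integral_real_affine[of "- 1" "\<lambda>z. escort q z * z" 0]
    by (simp add: escort_minus)
  then show ?thesis by simp
qed

text \<open>Integrability comes first, since the integral of a non-integrable function is 0 by
  convention.\<close>

lemma Z_q_pos: "Z_q q > 0"
proof -
  let ?f = "\<lambda>x. exp_q q (- x\<^sup>2)"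
  have [measurable]: "?f \<in> borel_measurable borel"
    using exp_q_measurable[of q 1] q by simp
  have pos: "?f x > 0" for x
    using q by (intro exp_q_pos) auto
  have int: "integrable lborel ?f"
  proof (rule Bochner_Integration.integrable_bound)
    show "integrable lborel (\<lambda>x. 2 * (?f x powr q * (1 + x\<^sup>2)))"
      using integrable_exp_q_powr[of 1] by simp
    show "AE x in lborel. norm (?f x) \<le> norm (2 * (?f x powr q * (1 + x\<^sup>2)))"
    proof (intro AE_I2)
      fix x :: real
      \<comment> \<open>The power \<open>1 - q\<close> of \<open>exp_q q (- x\<^sup>2)\<close> is
        the polynomial \<open>1 + (q - 1) * x\<^sup>2\<close>, at most
        \<open>2 * (1 + x\<^sup>2)\<close> since \<open>q < 3\<close>; so the bound for q-th powers
        also controls the first power.\<close>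
      have "?f x = ?f x powr q * ?f x powr (1 - q)"
        using pos[of x] by (simp flip: powr_add)
      also have "?f x powr (1 - q) = 1 + (q - 1) * x\<^sup>2"
        using ln_q_exp_q[of q "x\<^sup>2"] pos[of x] q
        by (cases "q = 1") (auto simp: ln_q_eq divide_simps algebra_simps)
      also have "?f x powr q * (1 + (q - 1) * x\<^sup>2) \<le> ?f x powr q * (2 * (1 + x\<^sup>2))"
        using mult_right_mono[of "q - 1" 2 "x\<^sup>2"] q by (intro mult_left_mono) auto
      finally show "norm (?f x) \<le> norm (2 * (?f x powr q * (1 + x\<^sup>2)))"
        using pos[of x] by (simp only: mult.left_commute[of _ 2]) simp
    qed
  qed measurable
  have "(LBINT x. ?f x) > 0"
    using pos by (intro lborel_integral_pos int) auto
  then show ?thesis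
    using q by (simp add: Z_q_def)
qed

section \<open>Admissible widths and pointwise values of q-Gaussians\<close>

lemma Sigma_q_iff: "\<sigma> \<in> Sigma_q q \<longleftrightarrow> Z_q q * \<sigma> > 1"
proof
  assume "\<sigma> \<in> Sigma_q q"
  then have "\<sigma> > 0" "1 / (Z_q q * \<sigma>) < 1" by (auto simp: Sigma_q_def)
  then show "Z_q q * \<sigma> > 1" using Z_q_pos by simp
next
  assume *: "Z_q q * \<sigma> > 1"
  then have "Z_q q * \<sigma> > 0" by linarith
  then have "\<sigma> > 0" using Z_q_pos by (rule zero_less_mult_pos)
  with * show "\<sigma> \<in> Sigma_q q" by (simp add: Sigma_q_def)
qed

lemma q_gaussian_eq:
  "q_gaussian q \<mu> \<sigma> x = exp_q q (- (((x - \<mu>) / \<sigma>)\<^sup>2 / (3 - q))) / (Z_q q * \<sigma>)"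
  by (simp add: q_gaussian_def)

lemma q_gaussian_bounds:
  assumes "\<sigma> \<in> Sigma_q q"
  shows "0 < q_gaussian q \<mu> \<sigma> x" "q_gaussian q \<mu> \<sigma> x < 1"
proof -
  let ?e = "exp_q q (- (((x - \<mu>) / \<sigma>)\<^sup>2 / (3 - q)))"
  have s: "Z_q q * \<sigma> > 1" using assms Sigma_q_iff by simp
  have e: "?e > 0" "?e \<le> 1"
    using q by (auto intro!: exp_q_pos exp_q_le_1)
  show "0 < q_gaussian q \<mu> \<sigma> x"
    unfolding q_gaussian_eq using s e by (intro divide_pos_pos) auto
  have "?e < Z_q q * \<sigma>" using s e by linarith
  then show "q_gaussian q \<mu> \<sigma> x < 1"
    unfolding q_gaussian_eq using s by (subst divide_less_eq_1_pos) auto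
qed

text \<open>The division rule at \<open>Z_q q * \<sigma>\<close>, arranged so that the prefactor is
  independent of the mean: two densities of equal width share it, and apart from it and the
  standardised variable the width enters only through the constant
  \<open>(3 - q) * ln_q q (Z_q q * \<sigma>)\<close>.\<close>

lemma ln_q_q_gaussian:
  assumes "\<sigma> \<in> Sigma_q q"
  shows "- ln_q q (q_gaussian q \<mu> \<sigma> x) = (Z_q q * \<sigma>) powr (q - 1) / (3 - q) *
    ((3 - q) * ln_q q (Z_q q * \<sigma>) + ((x - \<mu>) / \<sigma>)\<^sup>2)"
proof -
  have s: "Z_q q * \<sigma> > 0" using assms Sigma_q_iff by simp
  have y: "((x - \<mu>) / \<sigma>)\<^sup>2 / (3 - q) \<ge> 0" using q by simp
  show ?thesis
    unfolding q_gaussian_eq ln_q_divide[OF s exp_q_pos[OF q(1) y]] ln_q_exp_q[OF q(1) y]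
    using q by (simp add: distrib_left right_diff_distrib)
qed

end

section \<open>Cross entropies of translated q-Gaussians\<close>

lemma inverse_deriv_ln_qa:
  assumes "a \<noteq> 0" "0 < t" "t < 1"
  shows "1 / deriv (ln_qa q a) t = t powr q * (- ln_q q t) powr (1 - a)"
proof -
  have L: "- ln_q q t > 0" using ln_q_neg assms by simp
  have "(ln_qa q a has_real_derivative t powr (- q) * (- ln_q q t) powr (a - 1)) (at t)"
    unfolding ln_qa_def[abs_def] using L assms
    by (auto intro!: derivative_eq_intros has_real_derivative_ln_q)
  then have "deriv (ln_qa q a) t = t powr (- q) * (- ln_q q t) powr (a - 1)"
    by (rule DERIV_imp_deriv)
  moreover have "(- ln_q q t) powr (1 - a) = 1 / (- ln_q q t) powr (a - 1)"
    by (metis minus_diff_eq powr_minus_divide)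
  ultimately show ?thesis
    by (simp add: powr_minus_divide)
qed

text \<open>On the diagonal the exponents \<open>a\<close> and \<open>1 - a\<close> fall on the same
  base, which is positive because the density stays below 1, and they add up to 1.\<close>

lemma Ent_eq:
  assumes "1 \<le> q" "q < 3" "a \<noteq> 0" "p \<in> S_q q"
  shows "Ent q a p = (LBINT x. p x powr q * (- ln_q q (p x))) / a"
proof -
  obtain \<mu> \<sigma> where p: "p = q_gaussian q \<mu> \<sigma>" and \<sigma>: "\<sigma> \<in> Sigma_q q"
    using assms by (auto simp: S_q_def)
  have "ln_qa q a (p x) * (1 / deriv (ln_qa q a) (p x))
      = - (1 / a) * (p x powr q * (- ln_q q (p x)))" for x
  proof -
    have px: "0 < p x" "p x < 1"
      using q_gaussian_bounds[OF assms(1,2) \<sigma>] by (simp_all add: p)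
    have L: "- ln_q q (p x) > 0" using ln_q_neg px by simp
    have "(- ln_q q (p x)) powr a * (- ln_q q (p x)) powr (1 - a) = - ln_q q (p x)"
      using L by (simp flip: powr_add)
    then show ?thesis
      unfolding inverse_deriv_ln_qa[OF assms(3) px] ln_qa_def
      by (simp only: mult.assoc mult.left_commute[of "(- ln_q q (p x)) powr a"])
  qed
  then show ?thesis
    by (simp add: Ent_def cross_entropy_def)
qed

text \<open>The part of the cross-entropy integrand that depends on \<open>a\<close>, for equal
  widths and standardised means 0 (first density) and \<open>m\<close> (second density). It is
  homogeneous of degree 1 in its two bases.\<close>

definition cross_weight :: "real \<Rightarrow> real \<Rightarrow> real \<Rightarrow> real \<Rightarrow> real" where
  "cross_weight a k m z = (k + (z - m)\<^sup>2) powr a * (k + z\<^sup>2) powr (1 - a)"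

text \<open>Substitute \<open>x = \<sigma> * z\<close>. With \<open>s = Z_q q * \<sigma>\<close>,
  the factor \<open>s powr (- q)\<close> from the escort power, \<open>s powr (q - 1)\<close> from
  the logarithms and the Jacobian \<open>\<sigma>\<close> combine to \<open>1 / Z_q q\<close>, so
  the width survives only in the first parameter of \<open>cross_weight\<close>.\<close>

lemma cross_entropy_q_gaussian:
  assumes q: "1 \<le> q" "q < 3" and a: "a \<noteq> 0" and \<sigma>: "\<sigma> \<in> Sigma_q q"
  shows "cross_entropy q a (q_gaussian q 0 \<sigma>) (q_gaussian q (\<sigma> * m) \<sigma>)
    = (LBINT z. escort q z * cross_weight a ((3 - q) * ln_q q (Z_q q * \<sigma>)) m z)
      / (a * Z_q q * (3 - q))"
proof -
  define s where "s = Z_q q * \<sigma>"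
  define k where "k = (3 - q) * ln_q q s"
  define B where "B = s powr (q - 1) / (3 - q)"
  have s1: "s > 1" using \<sigma> Sigma_q_iff[OF q] by (simp add: s_def)
  have \<sigma>0: "\<sigma> > 0" using \<sigma> by (simp add: Sigma_q_def)
  have k: "k > 0" using ln_q_less[of 1 s q] s1 q by (simp add: k_def)
  have B: "B > 0" using s1 q by (simp add: B_def)
  let ?p = "q_gaussian q 0 \<sigma>" and ?r = "q_gaussian q (\<sigma> * m) \<sigma>"
  let ?I = "\<lambda>x. ln_qa q a (?r x) * (1 / deriv (ln_qa q a) (?p x))"
  have I: "?I (0 + \<sigma> * z) = - (s powr (- q) * B / a) * (escort q z * cross_weight a k m z)" for z
  proof -
    have z: "(\<sigma> * z - \<sigma> * m) / \<sigma> = z - m" "(\<sigma> * z - 0) / \<sigma> = z"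
      using \<sigma>0 by (simp_all add: field_simps)
    have Lp: "- ln_q q (?p (\<sigma> * z)) = B * (k + z\<^sup>2)"
      and Lr: "- ln_q q (?r (\<sigma> * z)) = B * (k + (z - m)\<^sup>2)"
      unfolding ln_q_q_gaussian[OF q \<sigma>] z by (simp_all add: B_def k_def s_def)
    have "exp_q q (- (z\<^sup>2 / (3 - q))) > 0"
      using q by (intro exp_q_pos) auto
    then have pq: "?p (\<sigma> * z) powr q = escort q z * s powr (- q)"
      unfolding q_gaussian_eq[OF q] z using s1
      by (simp add: escort_def powr_divide powr_minus_divide s_def)
    have w: "k + z\<^sup>2 > 0" "k + (z - m)\<^sup>2 > 0" using k by (simp_all add: add_pos_nonneg)
    \<comment> \<open>Both logarithms carry the factor \<open>B\<close>; as the exponents add up to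
      1, it leaves the product linearly.\<close>
    have BB: "B powr a * B powr (1 - a) = B" using B by (simp flip: powr_add)
    have "?I (\<sigma> * z) = - (1 / a) * (B * (k + (z - m)\<^sup>2)) powr a *
        (escort q z * s powr (- q) * (B * (k + z\<^sup>2)) powr (1 - a))"
      unfolding inverse_deriv_ln_qa[OF a q_gaussian_bounds[OF q \<sigma>]] ln_qa_def Lp Lr pq ..
    also have "\<dots> = - (s powr (- q) * (B powr a * B powr (1 - a)) / a) *
        (escort q z * cross_weight a k m z)"
      using w B by (simp add: powr_mult cross_weight_def)
    finally show ?thesis unfolding BB by simp
  qed
  have "(LBINT x. ?I x) = \<sigma> * (LBINT z. ?I (0 + \<sigma> * z))"
    using lborel_integral_real_affine[of \<sigma> ?I 0] \<sigma>0 by simp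
  also have "\<dots> = - (\<sigma> * (s powr (- q) * B) / a) * (LBINT z. escort q z * cross_weight a k m z)"
    unfolding I by simp
  also have "s powr (- q) * B = 1 / (s * (3 - q))"
  proof -
    have "s powr (- q) * s powr (q - 1) = s powr (- 1)"
      by (simp flip: powr_add)
    then show ?thesis
      using s1 by (simp add: B_def powr_minus_divide)
  qed
  finally show ?thesis
    using \<sigma>0 by (simp add: cross_entropy_def k_def s_def)
qed

section \<open>Strict convexity in the scale parameter\<close>

text \<open>The strict tangent inequality at 1. The factor \<open>a * (a - 1)\<close> carries the
  sign of the second derivative and so treats convex and concave powers together: after
  multiplication the derivative has the sign of \<open>y - 1\<close>, and the difference has a
  strict minimum 0 at 1.\<close>

lemma powr_tangent_less:
  fixes a x :: real
  assumes "a \<noteq> 0" "a \<noteq> 1" "x > 0" "x \<noteq> 1"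
  shows "a * (a - 1) * (x powr a - 1 - a * (x - 1)) > 0"
proof -
  define f where "f = (\<lambda>x::real. a * (a - 1) * (x powr a - 1 - a * (x - 1)))"
  have D: "(f has_real_derivative a\<^sup>2 * ((a - 1) * (y powr (a - 1) - 1))) (at y)" if "y > 0" for y
  proof -
    have "(f has_real_derivative a * (a - 1) * (a * y powr (a - 1) - 0 - a * (1 - 0))) (at y)"
      unfolding f_def using that
      by (intro DERIV_cmult DERIV_diff has_real_derivative_powr DERIV_const DERIV_ident) auto
    then show ?thesis by (simp add: power2_eq_square algebra_simps)
  qed
  have cont: "continuous_on S f" if "S \<subseteq> {0<..}" for S
    using that by (intro continuous_at_imp_continuous_on) (blast intro: DERIV_isCont D)
  have pos: "(a - 1) * (y powr (a - 1) - 1) > 0" if "y > 1" for y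
  proof (cases "a > 1")
    case True
    then show ?thesis using that powr_less_mono[of 0 "a - 1" y] by simp
  next
    case False
    then show ?thesis using that powr_less_mono[of "a - 1" 0 y] assms
      by (simp add: mult_neg_neg)
  qed
  have neg: "(a - 1) * (y powr (a - 1) - 1) < 0" if "0 < y" "y < 1" for y
  proof (cases "a > 1")
    case True
    then show ?thesis using that powr_less_mono'[of y 0 "a - 1"]
      by (simp add: mult_pos_neg)
  next
    case False
    then show ?thesis using that powr_less_mono'[of y "a - 1" 0] assms
      by (simp add: mult_neg_pos)
  qed
  have "f 1 < f x"
  proof (cases "x > 1")
    case True
    then show ?thesis
    proof (rule DERIV_pos_imp_increasing_open)
      show "\<exists>d. (f has_real_derivative d) (at y) \<and> 0 < d" if "1 < y" "y < x" for y
        using D[of y] pos[of y] that assms by force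
    qed (rule cont, auto)
  next
    case False
    then have "x < 1" using assms by simp
    then show ?thesis
    proof (rule DERIV_neg_imp_decreasing_open)
      show "\<exists>d. (f has_real_derivative d) (at y) \<and> d < 0" if "x < y" "y < 1" for y
        using D[of y] neg[of y] that assms
        by (intro exI[of _ "a\<^sup>2 * ((a - 1) * (y powr (a - 1) - 1))"]) (auto intro: mult_pos_neg)
    qed (rule cont, use assms in auto)
  qed
  then show ?thesis by (simp add: f_def)
qed

text \<open>The product is the perspective \<open>v * (u / v) powr a\<close> of the power function.
  The tangent inequality is applied to the normalised ratios with weights \<open>v\<^sub>1\<close>
  and \<open>v\<^sub>2\<close>; strictness comes from the two points lying on different
  rays.\<close>

lemma powr_perspective_less:
  fixes a u\<^sub>1 u\<^sub>2 v\<^sub>1 v\<^sub>2 :: real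
  assumes a: "a \<noteq> 0" "a \<noteq> 1"
    and pos: "u\<^sub>1 > 0" "u\<^sub>2 > 0" "v\<^sub>1 > 0" "v\<^sub>2 > 0" and ne: "u\<^sub>1 * v\<^sub>2 \<noteq> u\<^sub>2 * v\<^sub>1"
  shows "a * (a - 1) * (u\<^sub>1 powr a * v\<^sub>1 powr (1 - a) + u\<^sub>2 powr a * v\<^sub>2 powr (1 - a)
    - (u\<^sub>1 + u\<^sub>2) powr a * (v\<^sub>1 + v\<^sub>2) powr (1 - a)) > 0"
proof -
  define U V where "U = u\<^sub>1 + u\<^sub>2" and "V = v\<^sub>1 + v\<^sub>2"
  \<comment> \<open>Division by \<open>U / V\<close> makes the weighted mean of the ratios equal to
    1, so the tangent terms cancel in the sum.\<close>
  define x\<^sub>1 x\<^sub>2 where "x\<^sub>1 = (u\<^sub>1 / v\<^sub>1) / (U / V)" and "x\<^sub>2 = (u\<^sub>2 / v\<^sub>2) / (U / V)"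
  have UV: "U > 0" "V > 0" using pos by (auto simp: U_def V_def)
  have persp: "u powr a * v powr (1 - a) = v * (u / v) powr a" if "u > 0" "v > 0" for u v :: real
    using that by (simp add: powr_divide powr_diff)
  have e: "u powr a * v powr (1 - a) = (U / V) powr a * (v * ((u / v) / (U / V)) powr a)"
    if "u > 0" "v > 0" for u v
    using that UV by (simp only: persp powr_divide divide_pos_pos less_imp_le) simp
  have x: "x\<^sub>1 > 0" "x\<^sub>2 > 0" using pos UV by (auto simp: x\<^sub>1_def x\<^sub>2_def)
  have "x\<^sub>1 \<noteq> 1"
  proof
    assume "x\<^sub>1 = 1"
    then have "u\<^sub>1 * V = U * v\<^sub>1"
      using pos UV by (simp add: x\<^sub>1_def field_simps)
    then show False using ne by (simp add: U_def V_def algebra_simps)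
  qed
  then have 1: "v\<^sub>1 * (a * (a - 1) * (x\<^sub>1 powr a - 1 - a * (x\<^sub>1 - 1))) > 0"
    using powr_tangent_less[OF a x(1)] pos by simp
  have 2: "v\<^sub>2 * (a * (a - 1) * (x\<^sub>2 powr a - 1 - a * (x\<^sub>2 - 1))) \<ge> 0"
    using powr_tangent_less[OF a x(2)] pos by (cases "x\<^sub>2 = 1") (auto simp: less_imp_le)
  have "v\<^sub>1 * x\<^sub>1 + v\<^sub>2 * x\<^sub>2 = V"
    using pos UV by (simp add: x\<^sub>1_def x\<^sub>2_def U_def[symmetric] flip: add_divide_distrib distrib_right)
  then have lin: "v\<^sub>1 * (x\<^sub>1 - 1) + v\<^sub>2 * (x\<^sub>2 - 1) = 0"
    by (simp add: V_def algebra_simps)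
  have "v\<^sub>1 * (a * (a - 1) * (x\<^sub>1 powr a - 1 - a * (x\<^sub>1 - 1)))
      + v\<^sub>2 * (a * (a - 1) * (x\<^sub>2 powr a - 1 - a * (x\<^sub>2 - 1)))
      = a * (a - 1) * (v\<^sub>1 * x\<^sub>1 powr a + v\<^sub>2 * x\<^sub>2 powr a - V
          - a * (v\<^sub>1 * (x\<^sub>1 - 1) + v\<^sub>2 * (x\<^sub>2 - 1)))"
    by (simp add: V_def algebra_simps)
  with 1 2 have "a * (a - 1) * (v\<^sub>1 * x\<^sub>1 powr a + v\<^sub>2 * x\<^sub>2 powr a - V) > 0"
    unfolding lin by simp
  then have "(U / V) powr a * (a * (a - 1) * (v\<^sub>1 * x\<^sub>1 powr a + v\<^sub>2 * x\<^sub>2 powr a - V)) > 0"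
    using UV by simp
  also have "(U / V) powr a * (a * (a - 1) * (v\<^sub>1 * x\<^sub>1 powr a + v\<^sub>2 * x\<^sub>2 powr a - V))
      = a * (a - 1) * ((U / V) powr a * (v\<^sub>1 * x\<^sub>1 powr a) + (U / V) powr a * (v\<^sub>2 * x\<^sub>2 powr a)
        - V * (U / V) powr a)"
    by (simp add: algebra_simps)
  finally show ?thesis
    unfolding x\<^sub>1_def x\<^sub>2_def e[OF pos(1,3), symmetric] e[OF pos(2,4), symmetric]
      persp[OF UV, symmetric] by (simp add: U_def V_def)
qed

text \<open>By homogeneity, twice the value at the midpoint is the value at the sum of the two base
  pairs, where the perspective inequality applies.\<close>

lemma cross_weight_midpoint:
  assumes a: "a \<noteq> 0" "a \<noteq> 1" and k: "0 < k\<^sub>1" "k\<^sub>1 < k\<^sub>2" and ne: "(z - m)\<^sup>2 \<noteq> z\<^sup>2"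
  shows "a * (a - 1) * (cross_weight a k\<^sub>1 m z + cross_weight a k\<^sub>2 m z
    - 2 * cross_weight a ((k\<^sub>1 + k\<^sub>2) / 2) m z) > 0"
proof -
  let ?c = "\<lambda>k. cross_weight a k m z"
  define \<alpha> \<beta> where "\<alpha> = (z - m)\<^sup>2" and "\<beta> = z\<^sup>2"
  have nn: "\<alpha> \<ge> 0" "\<beta> \<ge> 0" by (auto simp: \<alpha>_def \<beta>_def)
  have c: "?c k = (k + \<alpha>) powr a * (k + \<beta>) powr (1 - a)" for k
    by (simp add: cross_weight_def \<alpha>_def \<beta>_def)
  have dbl: "2 * (A powr a * B powr (1 - a)) = (2 * A) powr a * (2 * B) powr (1 - a)"
    if "A \<ge> 0" "B \<ge> 0" for A B :: real
  proof -
    have "(2 * A) powr a * (2 * B) powr (1 - a)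
        = (2 powr a * 2 powr (1 - a)) * (A powr a * B powr (1 - a))"
      using that by (simp only: powr_mult mult_ac zero_le_numeral)
    also have "(2::real) powr a * 2 powr (1 - a) = 2" by (simp flip: powr_add)
    finally show ?thesis ..
  qed
  have 2: "2 * ((k\<^sub>1 + k\<^sub>2) / 2 + x) = (k\<^sub>1 + x) + (k\<^sub>2 + x)" for x by simp
  have hom: "2 * ?c ((k\<^sub>1 + k\<^sub>2) / 2)
      = ((k\<^sub>1 + \<alpha>) + (k\<^sub>2 + \<alpha>)) powr a * ((k\<^sub>1 + \<beta>) + (k\<^sub>2 + \<beta>)) powr (1 - a)"
    using nn k unfolding c by (subst dbl) (auto simp only: 2, auto)
  show ?thesis
    unfolding hom unfolding c
  proof (rule powr_perspective_less[OF a])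
    \<comment> \<open>This product is the difference of the two cross products below, so the base
      pairs are not proportional.\<close>
    have "(k\<^sub>2 - k\<^sub>1) * (\<alpha> - \<beta>) \<noteq> 0" using ne k by (simp add: \<alpha>_def \<beta>_def)
    then show "(k\<^sub>1 + \<alpha>) * (k\<^sub>2 + \<beta>) \<noteq> (k\<^sub>2 + \<alpha>) * (k\<^sub>1 + \<beta>)"
      by (simp add: algebra_simps)
  qed (use nn k in auto)
qed

section \<open>Integrating the strict inequality against the escort weight\<close>

lemma shift_square_le:
  fixes k m z :: real
  assumes "k > 0"
  shows "k + (z - m)\<^sup>2 \<le> (2 + 2 * m\<^sup>2 / k) * (k + z\<^sup>2)"
proof -
  \<comment> \<open>The parallelogram law; the leftover \<open>2 * m\<^sup>2\<close> is absorbed as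
    a multiple of \<open>k\<close>, which is where the constant comes from.\<close>
  have "(z - m)\<^sup>2 + (z + m)\<^sup>2 = 2 * z\<^sup>2 + 2 * m\<^sup>2"
    by (simp add: power2_eq_square algebra_simps)
  then have "(z - m)\<^sup>2 \<le> 2 * z\<^sup>2 + 2 * m\<^sup>2"
    using zero_le_power2[of "z + m"] by linarith
  moreover have "(2 + 2 * m\<^sup>2 / k) * (k + z\<^sup>2) = 2 * k + 2 * z\<^sup>2 + 2 * m\<^sup>2 + 2 * m\<^sup>2 / k * z\<^sup>2"
    using assms by (simp add: distrib_right distrib_left)
  moreover have "2 * m\<^sup>2 / k * z\<^sup>2 \<ge> 0" using assms by simp
  ultimately show ?thesis using assms by linarith
qed

text \<open>The two bases have ratio between \<open>1 / C\<close> and \<open>C\<close>, so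
  \<open>cross_weight\<close> is at most \<open>C powr \<bar>a\<bar>\<close> times the quadratic
  \<open>k + z\<^sup>2\<close>, whatever the sign of \<open>a\<close>.\<close>

lemma integrable_cross_weight:
  assumes q: "1 \<le> q" "q < 3" and k: "k > 0"
  shows "integrable lborel (\<lambda>z. escort q z * cross_weight a k m z)"
proof -
  define C where "C = 2 + 2 * m\<^sup>2 / k"
  note [measurable] = escort_measurable[OF q]
  show ?thesis
  proof (rule Bochner_Integration.integrable_bound)
    show "integrable lborel (\<lambda>z. C powr \<bar>a\<bar> * (k * escort q z + escort q z * z\<^sup>2))"
      using integrable_escort[OF q] integrable_escort_power2[OF q] by simp
    show "AE z in lborel. norm (escort q z * cross_weight a k m z)
        \<le> norm (C powr \<bar>a\<bar> * (k * escort q z + escort q z * z\<^sup>2))"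
    proof (intro AE_I2)
      fix z :: real
      let ?u = "k + (z - m)\<^sup>2" and ?v = "k + z\<^sup>2"
      have pos: "?u > 0" "?v > 0" using k by (simp_all add: add_pos_nonneg)
      \<comment> \<open>The shift bound at \<open>z - m\<close> with shift \<open>- m\<close>
        exchanges the roles of the two bases.\<close>
      have "?u \<le> C * ?v" "?v \<le> C * ?u"
        using shift_square_le[OF k, of z m] shift_square_le[OF k, of "z - m" "- m"]
        by (simp_all add: C_def)
      then have ratio: "?u / ?v \<le> C" "?v / ?u \<le> C"
        using pos by (simp_all add: pos_divide_le_eq)
      have "(?u / ?v) powr a \<le> C powr \<bar>a\<bar>"
      proof (cases "a \<ge> 0")
        case True
        then show ?thesis using ratio pos by (simp add: powr_mono2)
      next
        case False
        have "(?u / ?v) powr a = (?v / ?u) powr (- a)"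
          using pos by (simp add: powr_divide powr_minus_divide)
        also have "\<dots> \<le> C powr (- a)"
          using False ratio pos by (intro powr_mono2) auto
        finally show ?thesis using False by simp
      qed
      moreover have "cross_weight a k m z = (?u / ?v) powr a * ?v"
        using pos by (simp add: cross_weight_def powr_divide powr_diff)
      ultimately have "cross_weight a k m z \<le> C powr \<bar>a\<bar> * ?v"
        using pos by (simp add: mult_right_mono)
      then have "escort q z * cross_weight a k m z \<le> escort q z * (C powr \<bar>a\<bar> * ?v)"
        using escort_pos[OF q, of z] by (intro mult_left_mono) auto
      also have "\<dots> = C powr \<bar>a\<bar> * (k * escort q z + escort q z * z\<^sup>2)"
        by (simp add: algebra_simps)
      finally have le: "escort q z * cross_weight a k m z
          \<le> C powr \<bar>a\<bar> * (k * escort q z + escort q z * z\<^sup>2)" .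
      have "escort q z * cross_weight a k m z \<ge> 0"
        using escort_pos[OF q, of z] by (simp add: cross_weight_def)
      with le show "norm (escort q z * cross_weight a k m z)
          \<le> norm (C powr \<bar>a\<bar> * (k * escort q z + escort q z * z\<^sup>2))"
        by simp
    qed
  qed (simp add: cross_weight_def)
qed

text \<open>Equality would make the integral of the signed midpoint gap 0, although that gap is
  positive almost everywhere.\<close>

lemma integral_cross_weight_midpoint:
  assumes q: "1 \<le> q" "q < 3" and a: "a \<noteq> 0" "a \<noteq> 1"
    and k: "0 < k\<^sub>1" "k\<^sub>1 < k\<^sub>2" and m: "m \<noteq> 0"
  shows "(LBINT z. escort q z * cross_weight a k\<^sub>1 m z) + (LBINT z. escort q z * cross_weight a k\<^sub>2 m z)
    \<noteq> 2 * (LBINT z. escort q z * cross_weight a ((k\<^sub>1 + k\<^sub>2) / 2) m z)"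
proof
  define g where "g = (\<lambda>z. a * (a - 1) * (cross_weight a k\<^sub>1 m z + cross_weight a k\<^sub>2 m z
      - 2 * cross_weight a ((k\<^sub>1 + k\<^sub>2) / 2) m z))"
  have g_eq: "escort q z * g z = a * (a - 1) * (escort q z * cross_weight a k\<^sub>1 m z
      + escort q z * cross_weight a k\<^sub>2 m z
      - 2 * (escort q z * cross_weight a ((k\<^sub>1 + k\<^sub>2) / 2) m z))" for z
    by (simp add: g_def algebra_simps)
  have int: "integrable lborel (\<lambda>z. escort q z * cross_weight a k m z)" if "k > 0" for k
    using integrable_cross_weight[OF q that] .
  note ints = int[OF k(1)] int[of k\<^sub>2] int[of "(k\<^sub>1 + k\<^sub>2) / 2"]
  assume "(LBINT z. escort q z * cross_weight a k\<^sub>1 m z) + (LBINT z. escort q z * cross_weight a k\<^sub>2 m z)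
    = 2 * (LBINT z. escort q z * cross_weight a ((k\<^sub>1 + k\<^sub>2) / 2) m z)"
  then have "(LBINT z. escort q z * g z) = 0"
    unfolding g_eq using ints k by simp
  moreover have "integrable lborel (\<lambda>z. escort q z * g z)"
    unfolding g_eq using ints k by simp
  moreover have "AE z in lborel. escort q z * g z > 0"
    \<comment> \<open>The two squares agree only at \<open>m / 2\<close>, the one point where
      strictness fails.\<close>
    using AE_lborel_singleton[of "m / 2"]
  proof eventually_elim
    case (elim z)
    have "(z - m)\<^sup>2 - z\<^sup>2 = m * (m - 2 * z)"
      by (simp add: power2_eq_square algebra_simps)
    then have "(z - m)\<^sup>2 \<noteq> z\<^sup>2" using m elim by auto
    from cross_weight_midpoint[OF a k this] show ?case
      using escort_pos[OF q, of z] by (simp add: g_def)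
  qed
  ultimately show False
    using lborel_integral_pos[of "\<lambda>z. escort q z * g z"] by simp
qed

text \<open>Intermediate values: this supplies a width whose parameter \<open>k\<close> is the
  midpoint of those of two given widths.\<close>

lemma ln_q_midpoint:
  assumes "0 < s" "s < t"
  obtains x where "s < x" "x < t" "ln_q q x = (ln_q q s + ln_q q t) / 2"
proof -
  have lt: "ln_q q s < ln_q q t" using assms by (rule ln_q_less)
  have "continuous_on {s..t} (ln_q q)"
    using assms
    by (intro continuous_at_imp_continuous_on) (auto intro!: DERIV_isCont[OF has_real_derivative_ln_q])
  then obtain x where x: "s \<le> x" "x \<le> t" "ln_q q x = (ln_q q s + ln_q q t) / 2"
    using IVT'[of "ln_q q" s "(ln_q q s + ln_q q t) / 2" t] lt assms by auto
  with lt have "x \<noteq> s" "x \<noteq> t" by auto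
  with x show ?thesis by (intro that[of x]) auto
qed

section \<open>Proportionality forces affine dependence on the scale parameter\<close>

theorem theorem1:
  fixes q a :: real
  assumes "1 \<le> q" and "q < 3" and "a \<noteq> 0"
  shows "(\<forall>p\<in>S_q q. Ent q 1 p = a * Ent q a p) \<and>
    (a \<noteq> 1 \<longrightarrow>
      (\<forall>c::real. \<not> (\<forall>p\<in>S_q q. \<forall>r\<in>S_q q.
         rel_entropy q 1 p r = c * rel_entropy q a p r)))"
proof (intro conjI ballI impI allI notI)
  show "Ent q 1 p = a * Ent q a p" if "p \<in> S_q q" for p
    using that assms by (simp add: Ent_eq)
next
  fix c
  assume a1: "a \<noteq> 1"
    and H: "\<forall>p\<in>S_q q. \<forall>r\<in>S_q q. rel_entropy q 1 p r = c * rel_entropy q a p r"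
  note q = assms(1,2) and a = assms(3)
  define J where "J = (\<lambda>a k m. LBINT z. escort q z * cross_weight a k m z)"
  define E0 where "E0 = (LBINT z. escort q z)"
  define E2 where "E2 = (LBINT z. escort q z * z\<^sup>2)"
  define K where "K = (\<lambda>s. (3 - q) * ln_q q s)"
  note ints = integrable_escort[OF q] integrable_escort_ident[OF q] integrable_escort_power2[OF q]
  have "E0 > 0"
    unfolding E0_def using escort_pos[OF q] by (intro lborel_integral_pos integrable_escort q) auto
  \<comment> \<open>For equal means the two bases coincide, so the value is the same for every
    exponent \<open>b\<close>.\<close>
  have J0: "J b k 0 = k * E0 + E2" if "k > 0" for b k
  proof -
    have "cross_weight b k 0 z = k + z\<^sup>2" for z
      using that add_pos_nonneg[OF that zero_le_power2[of z]]
      by (simp add: cross_weight_def flip: powr_add)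
    then have "J b k 0 = (LBINT z. k * escort q z + escort q z * z\<^sup>2)"
      by (simp add: J_def algebra_simps)
    then show ?thesis using ints by (simp add: E0_def E2_def)
  qed
  \<comment> \<open>The first moment vanishes, so the shift by 1 adds just \<open>E0\<close> to the
    value at \<open>m = 0\<close>; the relative entropy for \<open>a = 1\<close> therefore does not
    see \<open>k\<close>.\<close>
  have J1: "J 1 k 1 = (k + 1) * E0 + E2" if "k > 0" for k
  proof -
    have "cross_weight 1 k 1 z = k + (z - 1)\<^sup>2" for z
      using that add_pos_nonneg[OF that zero_le_power2[of z]]
        add_pos_nonneg[OF that zero_le_power2[of "z - 1"]]
      by (simp add: cross_weight_def)
    then have "escort q z * cross_weight 1 k 1 z
        = (k + 1) * escort q z - 2 * (escort q z * z) + escort q z * z\<^sup>2" for z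
      by (simp only: power2_eq_square) (simp add: algebra_simps)
    then have "J 1 k 1 = (LBINT z. (k + 1) * escort q z - 2 * (escort q z * z) + escort q z * z\<^sup>2)"
      by (simp add: J_def)
    then show ?thesis
      using ints integral_escort_ident[OF q] by (simp add: E0_def E2_def)
  qed
  \<comment> \<open>Proportionality for means 0 and \<open>\<sigma>\<close>, with
    \<open>\<sigma>\<close> chosen so that \<open>Z_q q * \<sigma> = s\<close>. The left side does
    not depend on \<open>s\<close>.\<close>
  have key: "a * E0 = c * (J a (K s) 1 - (K s * E0 + E2))" if "s > 1" for s
  proof -
    have Kpos: "K s > 0" using ln_q_less[of 1 s q] that q by (simp add: K_def)
    define \<sigma> where "\<sigma> = s / Z_q q"
    have Z: "Z_q q > 0" using Z_q_pos[OF q] .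
    then have Zs: "Z_q q * \<sigma> = s" by (simp add: \<sigma>_def)
    then have \<sigma>: "\<sigma> \<in> Sigma_q q" using that Sigma_q_iff[OF q] by simp
    have "rel_entropy q b (q_gaussian q 0 \<sigma>) (q_gaussian q \<sigma> \<sigma>)
        = (J b (K s) 1 - J b (K s) 0) / (b * Z_q q * (3 - q))" if "b \<noteq> 0" for b
      using cross_entropy_q_gaussian[OF q that \<sigma>, of 0] cross_entropy_q_gaussian[OF q that \<sigma>, of 1]
      by (simp add: rel_entropy_def Zs J_def K_def diff_divide_distrib)
    moreover have S: "q_gaussian q \<mu> \<sigma> \<in> S_q q" for \<mu>
      using \<sigma> by (auto simp: S_q_def)
    moreover have "rel_entropy q 1 (q_gaussian q 0 \<sigma>) (q_gaussian q \<sigma> \<sigma>)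
        = c * rel_entropy q a (q_gaussian q 0 \<sigma>) (q_gaussian q \<sigma> \<sigma>)"
      using H S by blast
    ultimately have "(J 1 (K s) 1 - J 1 (K s) 0) / (1 * Z_q q * (3 - q))
        = c * ((J a (K s) 1 - J a (K s) 0) / (a * Z_q q * (3 - q)))"
      using a by simp
    then have "E0 / (Z_q q * (3 - q)) = c * (J a (K s) 1 - (K s * E0 + E2)) / a / (Z_q q * (3 - q))"
      by (simp add: J0[OF Kpos] J1[OF Kpos] algebra_simps)
    then have "E0 = c * (J a (K s) 1 - (K s * E0 + E2)) / a"
      using Z q by (subst (asm) divide_cancel_right) auto
    then show ?thesis using a by (simp add: field_simps)
  qed
  \<comment> \<open>For \<open>c = 0\<close> the identity \<open>key\<close> would read
    \<open>a * E0 = 0\<close>.\<close>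
  have "c \<noteq> 0" using key[of 2] \<open>E0 > 0\<close> a by auto
  \<comment> \<open>The numbers 2 and 3 are an arbitrary pair above 1.\<close>
  obtain x where x: "2 < x" "x < 3" "ln_q q x = (ln_q q 2 + ln_q q 3) / 2"
    using ln_q_midpoint[of 2 3] by auto
  have Kx: "K x = (K 2 + K 3) / 2" by (simp add: K_def x(3) distrib_left)
  \<comment> \<open>So \<open>c * J a k 1\<close> is affine in \<open>k = K s\<close>, and therefore
    satisfies the midpoint equality that strict convexity or concavity forbids.\<close>
  have J: "c * J a (K s) 1 = a * E0 + c * E2 + c * E0 * K s" if "s > 1" for s
    using key[OF that] by (simp add: algebra_simps)
  have "c * E0 * K 2 + c * E0 * K 3 = 2 * (c * E0 * K x)"
    by (simp add: Kx distrib_left)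
  then have "c * (J a (K 2) 1 + J a (K 3) 1) = c * (2 * J a ((K 2 + K 3) / 2) 1)"
    using J[of 2] J[of 3] J[of x] x(1) unfolding Kx[symmetric]
    by (simp only: distrib_left mult.left_commute[of c 2])
  then have "J a (K 2) 1 + J a (K 3) 1 = 2 * J a ((K 2 + K 3) / 2) 1"
    using \<open>c \<noteq> 0\<close> by simp
  moreover have "0 < K 2" "K 2 < K 3"
    using ln_q_less[of 1 2 q] ln_q_less[of 2 3 q] q by (auto simp: K_def)
  ultimately show False
    using integral_cross_weight_midpoint[OF q a a1, of "K 2" "K 3" 1] by (simp add: J_def)
qed

end
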